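(* Let $k>0$. Let $D$ be the region enclosed by the deltoid $$x(t)=(2\cos t+\cos2t,\ 2\sin t-\sin2t),\qquad t\in[-\pi,\pi],$$ having a constant refractive index $0<q\neq1$. Let $u^{\mathrm{in}}$ be an incident wave with wave number $k$ such that $u^{\mathrm{in}}(3,0)\neq0$. Then $u^{\mathrm{in}}$ is scattered by $D$.
   Context: An incident wave with wave number $k>0$ is a non-trivial solution $u^{\mathrm{in}}$ of $\Delta u^{\mathrm{in}}+k^2u^{\mathrm{in}}=0$ in $\mathbb R^2$. For a bounded simply connected planar domain $D$ (cusps on the boundary are allowed) with constant refractive index $q$ (the index is $1$ outside $D$), $u^{\mathrm{in}}$ is called nonscattering for $D$ if there is $u\in H^2_{\mathrm{loc}}(\mathbb R^2)$ with $u=0$ in $\mathbb R^2\setminus D$ and $\Delta u+k^2qu=k^2(1-q)u^{\mathrm{in}}\chi_D$ in $\mathbb R^2$, where $\chi_D$ is the indicator function of $D$ (here $u$ is the total field minus $u^{\mathrm{in}}$). Otherwise $u^{\mathrm{in}}$ is said to be scattered by $D$. *)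

theory Defs
  imports "HOL-Analysis.Analysis"
begin

definition partial_deriv :: "'a::euclidean_space \<Rightarrow> ('a \<Rightarrow> complex) \<Rightarrow> 'a \<Rightarrow> complex" where
  "partial_deriv i f = (\<lambda>x. frechet_derivative f (at x) i)"

definition laplacian :: "('a::euclidean_space \<Rightarrow> complex) \<Rightarrow> 'a \<Rightarrow> complex" where
  "laplacian f = (\<lambda>x. \<Sum>i\<in>Basis. partial_deriv i (partial_deriv i f) x)"

text \<open>Functions of class \<open>C\<^sup>n\<close> on the whole space.\<close>

fun C_class :: "nat \<Rightarrow> ('a::euclidean_space \<Rightarrow> complex) \<Rightarrow> bool" where
  "C_class 0 f \<longleftrightarrow> continuous_on UNIV f"
| "C_class (Suc n) f \<longleftrightarrow>
     (\<forall>x. f differentiable (at x)) \<and> (\<forall>i\<in>Basis. C_class n (partial_deriv i f))"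

definition test_function :: "('a::euclidean_space \<Rightarrow> complex) \<Rightarrow> bool" where
  "test_function \<phi> \<longleftrightarrow> (\<forall>n. C_class n \<phi>) \<and> compact (closure {x. \<phi> x \<noteq> 0})"

definition L1_loc :: "('a::euclidean_space \<Rightarrow> complex) \<Rightarrow> bool" where
  "L1_loc u \<longleftrightarrow> u \<in> borel_measurable lebesgue \<and>
     (\<forall>K. compact K \<longrightarrow> set_integrable lebesgue K (\<lambda>x. norm (u x)))"

definition L2_loc :: "('a::euclidean_space \<Rightarrow> complex) \<Rightarrow> bool" where
  "L2_loc u \<longleftrightarrow> u \<in> borel_measurable lebesgue \<and>
     (\<forall>K. compact K \<longrightarrow> set_integrable lebesgue K (\<lambda>x. (norm (u x))\<^sup>2))"

text \<open>\<open>has_weak_partial i u v\<close>: the distributional derivative of \<open>u\<close> in direction \<open>i\<close> is the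
  locally integrable function \<open>v\<close> (which is unique up to null sets).\<close>

definition has_weak_partial ::
    "'a::euclidean_space \<Rightarrow> ('a \<Rightarrow> complex) \<Rightarrow> ('a \<Rightarrow> complex) \<Rightarrow> bool" where
  "has_weak_partial i u v \<longleftrightarrow> L1_loc u \<and> L1_loc v \<and>
     (\<forall>\<phi>. test_function \<phi> \<longrightarrow>
        (LINT x|lebesgue. u x * partial_deriv i \<phi> x) = - (LINT x|lebesgue. v x * \<phi> x))"

definition H2_loc :: "('a::euclidean_space \<Rightarrow> complex) \<Rightarrow> bool" where
  "H2_loc u \<longleftrightarrow> L2_loc u \<and>
     (\<exists>g h. \<forall>i\<in>Basis. has_weak_partial i u (g i) \<and> L2_loc (g i) \<and>
        (\<forall>j\<in>Basis. has_weak_partial j (g i) (h i j) \<and> L2_loc (h i j)))"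

definition has_weak_laplacian :: "('a::euclidean_space \<Rightarrow> complex) \<Rightarrow> ('a \<Rightarrow> complex) \<Rightarrow> bool" where
  "has_weak_laplacian u w \<longleftrightarrow>
     (\<exists>g h. (\<forall>i\<in>Basis. has_weak_partial i u (g i) \<and> has_weak_partial i (g i) (h i)) \<and>
        w = (\<lambda>x. \<Sum>i\<in>Basis. h i x))"

text \<open>The plane is \<^typ>\<open>real \<times> real\<close>. By elliptic regularity it does not matter in which sense
  the Helmholtz equation is solved here; we take classical solutions.\<close>

definition incident_wave :: "real \<Rightarrow> (real \<times> real \<Rightarrow> complex) \<Rightarrow> bool" where
  "incident_wave k uin \<longleftrightarrow> C_class 2 uin \<and> (\<exists>x. uin x \<noteq> 0) \<and>
     (\<forall>x. laplacian uin x + complex_of_real (k\<^sup>2) * uin x = 0)"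

text \<open>Elements of \<open>H\<^sup>2\<^sub>l\<^sub>o\<^sub>c\<close> are determined up to null sets, so \<open>u = 0\<close> outside \<open>D\<close> and the
  equation are required almost everywhere.\<close>

definition nonscattering ::
    "real \<Rightarrow> real \<Rightarrow> (real \<times> real) set \<Rightarrow> (real \<times> real \<Rightarrow> complex) \<Rightarrow> bool" where
  "nonscattering k q D uin \<longleftrightarrow>
     (\<exists>u. H2_loc u \<and>
          (AE x in lebesgue. x \<notin> D \<longrightarrow> u x = 0) \<and>
          (\<exists>w. has_weak_laplacian u w \<and>
             (AE x in lebesgue. w x + complex_of_real (k\<^sup>2 * q) * u x =
                complex_of_real (k\<^sup>2 * (1 - q)) * uin x * indicator D x)))"

definition scattered ::
    "real \<Rightarrow> real \<Rightarrow> (real \<times> real) set \<Rightarrow> (real \<times> real \<Rightarrow> complex) \<Rightarrow> bool" where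
  "scattered k q D uin \<longleftrightarrow> \<not> nonscattering k q D uin"

definition deltoid :: "real \<Rightarrow> real \<times> real" where
  "deltoid t = (2 * cos t + cos (2 * t), 2 * sin t - sin (2 * t))"

definition deltoid_region :: "(real \<times> real) set" where
  "deltoid_region = inside (deltoid ` {-pi..pi})"

end

theory Submission
  imports Defs
begin

text \<open>Extended by zero, \<open>u\<close> has compact support, so pairing the equation with a solution
  \<open>v\<close> of \<open>\<Delta>v + k\<^sup>2qv = 0\<close> shows that \<open>\<integral>\<^sub>D u\<^sup>i\<^sup>n v = 0\<close>. Take
  \<open>v(x, y) = exp (a(x - 3) + \<i>by)\<close> with \<open>b\<^sup>2 = a\<^sup>2 + k\<^sup>2q\<close> and let \<open>a \<rightarrow> \<infinity>\<close>. The
  integral concentrates at the point of \<open>D\<close> with the largest abscissa, which is the cusp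
  \<open>(3, 0)\<close>. There \<open>\<bar>y\<bar>\<close> is of order \<open>(3 - x)\<^bsup>3/2\<^esup>\<close>, hence \<open>by\<close> is small where
  \<open>3 - x\<close> is of order \<open>1/a\<close>, no oscillation takes place, and the integral is
  asymptotically \<open>u\<^sup>i\<^sup>n(3, 0)\<close> times \<open>\<integral>\<^sub>D exp (a(x - 3))\<close>, which decays only
  polynomially. So \<open>u\<^sup>i\<^sup>n(3, 0) = 0\<close>.\<close>

subsection \<open>Smooth functions and cutoffs\<close>

lemma partial_deriv_eqI:
  assumes "(f has_derivative f') (at x)"
  shows "partial_deriv i f x = f' i"
  using frechet_derivative_at[OF assms] by (simp add: partial_deriv_def)

lemma partial_deriv_cong_open:
  assumes "open S" "x \<in> S" and eq: "\<And>y. y \<in> S \<Longrightarrow> f y = g y"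
  shows "partial_deriv i f x = partial_deriv i g x"
proof -
  have "(f has_derivative f') (at x) \<longleftrightarrow> (g has_derivative f') (at x)" for f'
    using assms has_derivative_transform_within_open[OF _ assms(1,2)] by metis
  then show ?thesis by (simp add: partial_deriv_def frechet_derivative_def)
qed

section \<open>Closure properties of the classes C^n\<close>

lemma C_class_imp_continuous:
  assumes "C_class n f"
  shows "continuous_on UNIV f"
  using assms
  by (cases n) (auto simp: continuous_on_eq_continuous_at intro: differentiable_imp_continuous_within)

lemma C_class_SucD: "C_class (Suc n) f \<Longrightarrow> C_class n f"
proof (induction n arbitrary: f)
  case 0
  then show ?case using C_class_imp_continuous C_class.simps(1) by blast
qed auto

lemma C_class_SucI:
  assumes "\<And>x. (f has_derivative f' x) (at x)"
    and "\<And>i. i \<in> Basis \<Longrightarrow> C_class n (\<lambda>x. f' x i)"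
  shows "C_class (Suc n) f"
proof -
  have "partial_deriv i f = (\<lambda>x. f' x i)" for i
    by (rule ext) (rule partial_deriv_eqI[OF assms(1)])
  with assms show ?thesis by (auto simp: differentiable_def)
qed

lemma C_class_has_derivative:
  assumes "C_class (Suc n) f"
  shows "(f has_derivative (\<lambda>i. partial_deriv i f x)) (at x)"
  unfolding partial_deriv_def using assms frechet_derivative_works by auto

lemma C_class_const: "C_class n (\<lambda>x. c)"
proof (induction n arbitrary: c)
  case (Suc n)
  then show ?case by (intro C_class_SucI[where f' = "\<lambda>_ _. 0"]) auto
qed simp

lemma C_class_add: "C_class n f \<Longrightarrow> C_class n g \<Longrightarrow> C_class n (\<lambda>x. f x + g x)"
proof (induction n arbitrary: f g)
  case 0
  then show ?case by (auto intro: continuous_intros)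
next
  case (Suc n)
  show ?case
    by (rule C_class_SucI, rule has_derivative_add) (use Suc in \<open>auto intro: C_class_has_derivative\<close>)
qed

text \<open>The product rule brings back the undifferentiated factors, so the induction step also
  uses that class C^(n+1) is contained in class C^n.\<close>

lemma C_class_mult: "C_class n f \<Longrightarrow> C_class n g \<Longrightarrow> C_class n (\<lambda>x. f x * g x)"
proof (induction n arbitrary: f g)
  case 0
  then show ?case by (auto intro: continuous_intros)
next
  case (Suc n)
  have "C_class n f" "C_class n g" using Suc.prems C_class_SucD by auto
  with Suc show ?case
    by (intro C_class_SucI[OF has_derivative_mult[OF C_class_has_derivative C_class_has_derivative]]
        C_class_add Suc.IH) auto
qed

lemma C_class_minus: "C_class n f \<Longrightarrow> C_class n (\<lambda>x. - f x)"
  using C_class_mult[OF C_class_const[of n "-1"]] by simp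

lemma C_class_inverse:
  assumes "\<And>x. f x \<noteq> 0"
  shows "C_class n f \<Longrightarrow> C_class n (\<lambda>x. inverse (f x))"
proof (induction n)
  case 0
  then show ?case using assms by (auto intro: continuous_intros)
next
  case (Suc n)
  then have "C_class n (\<lambda>x. inverse (f x))" using C_class_SucD by blast
  with Suc.prems show ?case
    by (intro C_class_SucI[OF Deriv.has_derivative_inverse[OF assms C_class_has_derivative[of n f]]]
        C_class_minus C_class_mult) auto
qed

lemma C_class_compose:
  fixes h :: "real \<Rightarrow> complex" and r :: "'a::euclidean_space \<Rightarrow> real"
  assumes r: "\<And>x. (r has_derivative r' x) (at x)"
    and r': "\<And>n i. i \<in> Basis \<Longrightarrow> C_class n (\<lambda>x. complex_of_real (r' x i))"
  shows "C_class n h \<Longrightarrow> C_class n (\<lambda>x. h (r x))"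
proof (induction n arbitrary: h)
  case 0
  have "continuous_on UNIV r"
    using r by (meson continuous_at_imp_continuous_on has_derivative_continuous)
  with 0 show ?case using continuous_on_compose2[of UNIV h UNIV r] by auto
next
  case (Suc n)
  have D: "((\<lambda>x. h (r x)) has_derivative (\<lambda>v. partial_deriv (r' x v) h (r x))) (at x)" for x
    by (rule has_derivative_compose[OF r]) (rule C_class_has_derivative[OF Suc.prems])
  \<comment> \<open>The chain rule differentiates \<open>h\<close> in the direction
    \<open>r' x v\<close>. Linearity in the direction turns this into a scalar factor times the
    ordinary derivative of \<open>h\<close>, to which the induction hypothesis applies.\<close>
  have lin: "partial_deriv s h t = complex_of_real s * partial_deriv 1 h t" for s t
    using linear_scale[OF has_derivative_linear[OF C_class_has_derivative[OF Suc.prems]], of s 1]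
    by (simp add: scaleR_conv_of_real)
  show ?case
    by (rule C_class_SucI[OF D], subst lin) (use Suc r' in \<open>auto intro: C_class_mult\<close>)
qed

lemma has_derivative_exp_linear:
  fixes L :: "'a::real_normed_vector \<Rightarrow> complex"
  assumes "bounded_linear L"
  shows "((\<lambda>x. c * exp (L x)) has_derivative (\<lambda>v. c * L v * exp (L x))) (at x)"
proof -
  have "((\<lambda>z. c * exp z) has_derivative (*) (c * exp (L x))) (at (L x))"
    by (intro has_field_derivative_imp_has_derivative) (auto intro!: derivative_eq_intros)
  from has_derivative_compose[OF bounded_linear_imp_has_derivative[OF assms] this]
  show ?thesis by (simp add: mult_ac)
qed

lemma C_class_exp_linear:
  assumes "bounded_linear L"
  shows "C_class n (\<lambda>x. exp (L x))"
proof (induction n)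
  case 0
  show ?case using assms by (auto intro!: continuous_intros simp: linear_continuous_on)
next
  case (Suc n)
  then show ?case using has_derivative_exp_linear[OF assms, where c = 1]
    by (intro C_class_SucI[where f' = "\<lambda>x v. L v * exp (L x)"] C_class_mult C_class_const) simp_all
qed

text \<open>Derivatives of \<open>flat m\<close> stay in the span of the family, whence the smoothness of \<open>flat 0\<close>.\<close>

definition flat :: "nat \<Rightarrow> real \<Rightarrow> complex" where
  "flat m x = (if x > 0 then complex_of_real (inverse x ^ m * exp (- inverse x)) else 0)"

lemma flat_tendsto_0: "(flat m \<longlongrightarrow> 0) (at 0)"
proof -
  have "((\<lambda>x::real. inverse x ^ m * exp (- inverse x)) \<longlongrightarrow> 0) (at_right 0)"
    using filterlim_compose[OF tendsto_power_div_exp_0[of m] filterlim_inverse_at_top_right]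
    by (simp add: exp_minus divide_inverse)
  then have "((\<lambda>x. complex_of_real (inverse x ^ m * exp (- inverse x))) \<longlongrightarrow> 0) (at_right 0)"
    by (metis of_real_0 tendsto_of_real)
  then have "(flat m \<longlongrightarrow> 0) (at_right 0)"
    by (rule Lim_transform_eventually) (auto simp: flat_def eventually_at_filter)
  moreover have "(flat m \<longlongrightarrow> 0) (at_left 0)"
    by (rule tendsto_eventually) (auto simp: flat_def eventually_at_filter)
  ultimately show ?thesis using filterlim_split_at by blast
qed

lemma flat_has_vector_derivative:
  "(flat m has_vector_derivative (flat (m + 2) x - of_nat m * flat (m + 1) x)) (at x)"
proof (cases x "0 :: real" rule: linorder_cases)
  case less
  have "(flat m has_vector_derivative 0) (at x)"
    by (rule has_vector_derivative_transform_within_open[where f = "\<lambda>_. 0" and S = "{..<0}"])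
      (use less in \<open>auto simp: flat_def\<close>)
  with less show ?thesis by (simp add: flat_def)
next
  case greater
  have "((\<lambda>x. inverse x ^ m * exp (- inverse x)) has_real_derivative
      (inverse x ^ (m + 2) * exp (- inverse x) - m * (inverse x ^ (m + 1) * exp (- inverse x)))) (at x)"
    using greater
    apply (auto intro!: derivative_eq_intros)
    \<comment> \<open>The power rule produces the exponent \<open>m - 1\<close>, which is truncated
      at \<open>m = 0\<close>.\<close>
    apply (cases m; simp add: field_simps power2_eq_square)
    done
  then have "((\<lambda>x. complex_of_real (inverse x ^ m * exp (- inverse x))) has_vector_derivative
      complex_of_real (inverse x ^ (m + 2) * exp (- inverse x) - m * (inverse x ^ (m + 1) * exp (- inverse x)))) (at x)"
    by (rule has_vector_derivative_of_real)
  then have "(flat m has_vector_derivative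
      complex_of_real (inverse x ^ (m + 2) * exp (- inverse x) - m * (inverse x ^ (m + 1) * exp (- inverse x)))) (at x)"
    by (rule has_vector_derivative_transform_within_open[where S = "{0<..}"])
      (use greater in \<open>auto simp: flat_def\<close>)
  with greater show ?thesis by (simp add: flat_def)
next
  case equal
  \<comment> \<open>The difference quotient of \<open>flat m\<close> at 0 has the same norm as
    \<open>flat (m + 1) h\<close>: dividing by h > 0 adds one factor 1/h, and for h < 0 both
    vanish.\<close>
  have "((\<lambda>h. norm (flat (m + 1) h)) \<longlongrightarrow> 0) (at 0)"
    using tendsto_norm_zero[OF flat_tendsto_0] .
  then have "((\<lambda>h. norm (flat m (0 + h) - flat m 0 - h *\<^sub>R 0) / norm h) \<longlongrightarrow> 0) (at 0)"
    by (rule Lim_transform_eventually)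
      (auto simp: flat_def eventually_at_filter norm_mult norm_power norm_inverse divide_inverse)
  then have "(flat m has_vector_derivative 0) (at 0)"
    by (simp add: has_vector_derivative_def has_derivative_at)
  with equal show ?thesis by (simp add: flat_def)
qed

lemma C_class_flat: "C_class n (flat m)"
proof (induction n arbitrary: m)
  case 0
  then show ?case
    using flat_has_vector_derivative
    by (auto intro!: continuous_at_imp_continuous_on has_vector_derivative_continuous)
next
  case (Suc n)
  have D: "(flat m has_derivative
      (\<lambda>h. complex_of_real h * (flat (m + 2) x + - (of_nat m * flat (m + 1) x)))) (at x)" for x
    using flat_has_vector_derivative[of m x]
    by (simp add: has_vector_derivative_def scaleR_conv_of_real)
  show ?case
    by (intro C_class_SucI[OF D] C_class_add C_class_mult C_class_minus C_class_const Suc)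
qed

text \<open>One of t and 1 - t is positive. This is the denominator of the smooth step
  below.\<close>

lemma flat_add_neq_0: "flat 0 t + flat 0 (1 - t) \<noteq> 0"
proof -
  have "Re (flat 0 t + flat 0 (1 - t)) > 0" by (auto simp: flat_def add_pos_pos)
  then show ?thesis by (metis less_irrefl zero_complex.sel(1))
qed

text \<open>The profile \<open>g\<close> is a smooth step, 0 for t \<le> 0 and 1 for t \<ge> 1.
  Composing it with the polynomial R^2 + 1 - |x|^2 rather than with the norm keeps everything smooth
  at the origin.\<close>

lemma ex_test_function_eq_1_on_ball:
  fixes R :: real
  shows "\<exists>\<eta> :: 'a::euclidean_space \<Rightarrow> complex. test_function \<eta> \<and> (\<forall>x\<in>ball 0 R. \<eta> x = 1)"
proof -
  define g where "g t = flat 0 t * inverse (flat 0 t + flat 0 (1 - t))" for t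
  define r :: "'a \<Rightarrow> real" where "r x = R\<^sup>2 + 1 - x \<bullet> x" for x
  have r: "(r has_derivative (\<lambda>v. - 2 * (x \<bullet> v))) (at x)" for x
    unfolding r_def by (auto intro!: derivative_eq_intros simp: inner_commute)
  have ident: "C_class n (\<lambda>t. complex_of_real t)" for n
  proof (cases n)
    case (Suc m)
    show ?thesis unfolding Suc
      by (rule C_class_SucI[where f' = "\<lambda>_. complex_of_real"])
        (auto intro: C_class_const bounded_linear_imp_has_derivative bounded_linear_of_real)
  qed (auto intro!: continuous_intros)
  have one_minus: "((\<lambda>t::real. 1 - t) has_derivative (\<lambda>v. - v)) (at t)" for t
    by (auto intro!: derivative_eq_intros)
  have "C_class n (\<lambda>t. flat 0 (1 - t))" for n
    by (rule C_class_compose[OF one_minus, where h = "flat 0"]) (auto intro: C_class_const C_class_flat)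
  then have g: "C_class n g" for n
    unfolding g_def using flat_add_neq_0
    by (intro C_class_mult C_class_inverse C_class_add C_class_flat)
  have inner: "C_class n (\<lambda>x. complex_of_real (x \<bullet> i))" for n and i :: 'a
    by (rule C_class_compose[where h = complex_of_real and r = "\<lambda>x. x \<bullet> i" and r' = "\<lambda>_ v. v \<bullet> i"])
      (auto intro: bounded_linear_imp_has_derivative bounded_linear_inner_left C_class_const ident)
  have "C_class n (\<lambda>x. complex_of_real (- 2) * complex_of_real (x \<bullet> i))" for n and i :: 'a
    by (intro C_class_mult C_class_const inner)
  then have smooth: "C_class n (\<lambda>x. g (r x))" for n
    by (intro C_class_compose[OF r, where h = g] g) auto
  have "{x. g (r x) \<noteq> 0} \<subseteq> cball 0 (R\<^sup>2 + 1)"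
  proof
    fix x assume "x \<in> {x. g (r x) \<noteq> 0}"
    then have "r x > 0" by (auto simp: g_def flat_def split: if_splits)
    then have "(norm x)\<^sup>2 < R\<^sup>2 + 1" by (simp add: r_def dot_square_norm)
    \<comment> \<open>Since R^2 + 1 \<ge> 1, its square root may be replaced by R^2 + 1 itself as a
      radius.\<close>
    moreover have "(R\<^sup>2 + 1) * 1 \<le> (R\<^sup>2 + 1) * (R\<^sup>2 + 1)" by (intro mult_left_mono) auto
    ultimately have "(norm x)\<^sup>2 \<le> (R\<^sup>2 + 1)\<^sup>2" by (simp add: power2_eq_square)
    then have "norm x \<le> R\<^sup>2 + 1" by (rule power2_le_imp_le) simp
    then show "x \<in> cball 0 (R\<^sup>2 + 1)" by simp
  qed
  then have "compact (closure {x. g (r x) \<noteq> 0})"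
    using bounded_subset bounded_cball compact_closure by blast
  moreover have "g (r x) = 1" if "x \<in> ball 0 R" for x
  proof -
    have "(norm x)\<^sup>2 \<le> R\<^sup>2" using that by (intro power_mono) auto
    then have "r x \<ge> 1" by (simp add: r_def dot_square_norm)
    then have "flat 0 (1 - r x) = 0" "flat 0 (r x) \<noteq> 0" by (auto simp: flat_def)
    then show ?thesis by (simp add: g_def)
  qed
  ultimately show ?thesis
    using smooth unfolding test_function_def by (intro exI[of _ "\<lambda>x. g (r x)"]) auto
qed

subsection \<open>Testing the equation with exponentials\<close>

lemma borel_measurable_lebesgue_continuous:
  fixes f :: "'a::euclidean_space \<Rightarrow> complex"
  shows "continuous_on UNIV f \<Longrightarrow> f \<in> borel_measurable lebesgue"
  by (simp add: borel_measurable_continuous_onI measurable_completion)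

lemma integrable_L1_loc_mult:
  assumes u: "L1_loc u" and \<phi>: "continuous_on UNIV \<phi>"
    and K: "compact K" "\<And>x. x \<notin> K \<Longrightarrow> \<phi> x = 0"
  shows "integrable lebesgue (\<lambda>x. u x * \<phi> x)"
proof -
  have "compact (\<phi> ` K)"
    using \<phi> K by (intro compact_continuous_image) (auto intro: continuous_on_subset)
  then obtain B where B: "\<And>x. x \<in> K \<Longrightarrow> norm (\<phi> x) \<le> B"
    by (metis bounded_iff compact_imp_bounded imageI)
  have "integrable lebesgue (\<lambda>x. B * (indicator K x *\<^sub>R norm (u x)))"
    using u K unfolding L1_loc_def set_integrable_def by (intro integrable_mult_right) auto
  moreover have "(\<lambda>x. u x * \<phi> x) \<in> borel_measurable lebesgue"
    using u borel_measurable_lebesgue_continuous[OF \<phi>] unfolding L1_loc_def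
    by (intro borel_measurable_times) auto
  moreover have "AE x in lebesgue. norm (u x * \<phi> x) \<le> norm (B * (indicator K x *\<^sub>R norm (u x)))"
  proof (intro AE_I2)
    fix x
    show "norm (u x * \<phi> x) \<le> norm (B * (indicator K x *\<^sub>R norm (u x)))"
    proof (cases "x \<in> K")
      case True
      have "norm (u x) * norm (\<phi> x) \<le> norm (u x) * \<bar>B\<bar>"
        using B[OF True] by (intro mult_left_mono) auto
      with True show ?thesis by (simp add: norm_mult abs_mult mult.commute)
    qed (simp add: K)
  qed
  ultimately show ?thesis by (rule Bochner_Integration.integrable_bound)
qed

section \<open>Integration by parts against test functions\<close>

lemma test_function_partial_deriv:
  assumes "test_function \<phi>" "i \<in> Basis"
  shows "test_function (partial_deriv i \<phi>)"
proof -
  let ?K = "closure {x. \<phi> x \<noteq> 0}"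
  have "partial_deriv i \<phi> x = 0" if "x \<notin> ?K" for x
  proof -
    have "partial_deriv i \<phi> x = partial_deriv i (\<lambda>_. 0) x"
      by (rule partial_deriv_cong_open[of "- ?K"]) (use that closure_subset[of "{x. \<phi> x \<noteq> 0}"] in auto)
    also have "\<dots> = 0" using partial_deriv_eqI[OF has_derivative_const] .
    finally show ?thesis .
  qed
  then have "{x. partial_deriv i \<phi> x \<noteq> 0} \<subseteq> ?K" by auto
  then have "closure {x. partial_deriv i \<phi> x \<noteq> 0} \<subseteq> ?K" by (simp add: closure_minimal)
  then have "compact (closure {x. partial_deriv i \<phi> x \<noteq> 0})"
    using assms(1) compact_Int_closed[of ?K "closure {x. partial_deriv i \<phi> x \<noteq> 0}"]
    by (simp add: test_function_def Int_absorb1)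
  moreover have "C_class n (partial_deriv i \<phi>)" for n
  proof -
    have "C_class (Suc n) \<phi>" using assms unfolding test_function_def by blast
    then show ?thesis using assms by simp
  qed
  ultimately show ?thesis unfolding test_function_def by blast
qed

lemma test_function_continuous: "test_function \<phi> \<Longrightarrow> continuous_on UNIV \<phi>"
  unfolding test_function_def using C_class_imp_continuous by blast

lemma integrable_L1_loc_test_function:
  assumes "L1_loc u" "test_function \<phi>"
  shows "integrable lebesgue (\<lambda>x. u x * \<phi> x)"
  using assms(2) closure_subset[of "{x. \<phi> x \<noteq> 0}"]
  by (intro integrable_L1_loc_mult[OF assms(1) test_function_continuous[OF assms(2)],
        of "closure {x. \<phi> x \<noteq> 0}"]) (auto simp: test_function_def)

text \<open>Two integrations by parts in each coordinate direction; the two signs cancel.\<close>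

lemma
  assumes "has_weak_laplacian u w" "test_function \<phi>"
  shows has_weak_laplacian_integrable: "integrable lebesgue (\<lambda>x. w x * \<phi> x)"
    and has_weak_laplacian_integral:
      "(LINT x|lebesgue. w x * \<phi> x) = (LINT x|lebesgue. u x * laplacian \<phi> x)"
proof -
  obtain g h where gh: "\<And>i. i \<in> Basis \<Longrightarrow> has_weak_partial i u (g i)"
      "\<And>i. i \<in> Basis \<Longrightarrow> has_weak_partial i (g i) (h i)"
    and w: "w = (\<lambda>x. \<Sum>i\<in>Basis. h i x)"
    using assms(1) unfolding has_weak_laplacian_def by blast
  have int: "integrable lebesgue (\<lambda>x. h i x * \<phi> x)" if "i \<in> Basis" for i
    using gh(2)[OF that] assms(2) by (intro integrable_L1_loc_test_function) (auto simp: has_weak_partial_def)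
  then show "integrable lebesgue (\<lambda>x. w x * \<phi> x)"
    unfolding w sum_distrib_right by (rule Bochner_Integration.integrable_sum)
  have int2: "integrable lebesgue (\<lambda>x. u x * partial_deriv i (partial_deriv i \<phi>) x)" if "i \<in> Basis" for i
    using gh(1)[OF that] assms(2) that
    by (intro integrable_L1_loc_test_function test_function_partial_deriv) (auto simp: has_weak_partial_def)
  have "(LINT x|lebesgue. w x * \<phi> x) = (\<Sum>i\<in>Basis. LINT x|lebesgue. h i x * \<phi> x)"
    unfolding w sum_distrib_right using int by (rule Bochner_Integration.integral_sum)
  also have "\<dots> = (\<Sum>i\<in>Basis. LINT x|lebesgue. u x * partial_deriv i (partial_deriv i \<phi>) x)"
  proof (rule sum.cong[OF refl])
    fix i :: 'a assume i: "i \<in> Basis"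
    have "(LINT x|lebesgue. h i x * \<phi> x) = - (LINT x|lebesgue. g i x * partial_deriv i \<phi> x)"
      using gh(2)[OF i] assms(2) unfolding has_weak_partial_def by simp
    also have "\<dots> = (LINT x|lebesgue. u x * partial_deriv i (partial_deriv i \<phi>) x)"
      using gh(1)[OF i] test_function_partial_deriv[OF assms(2) i] unfolding has_weak_partial_def by simp
    finally show "(LINT x|lebesgue. h i x * \<phi> x) = (LINT x|lebesgue. u x * partial_deriv i (partial_deriv i \<phi>) x)" .
  qed
  also have "\<dots> = (LINT x|lebesgue. u x * laplacian \<phi> x)"
    unfolding laplacian_def sum_distrib_left using int2
    by (rule Bochner_Integration.integral_sum[symmetric])
  finally show "(LINT x|lebesgue. w x * \<phi> x) = (LINT x|lebesgue. u x * laplacian \<phi> x)" .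
qed

lemma has_weak_laplacian_L1_loc: "has_weak_laplacian u w \<Longrightarrow> L1_loc u"
  unfolding has_weak_laplacian_def has_weak_partial_def using nonempty_Basis by blast

text \<open>The condition on \<open>L\<close> says that exp(L) solves \<Delta>v + k^2 q v = 0. It
  lacks compact support, so it is multiplied by a cutoff equal to 1 on a ball containing
  \<open>D\<close>; as \<open>u\<close> and the right-hand side vanish almost everywhere off
  \<open>D\<close>, the cutoff leaves no trace in the pairing.\<close>

lemma nonscattering_integral_exp_eq_0:
  assumes ns: "nonscattering k q D uin" and D: "bounded D" "D \<in> sets lebesgue"
    and k: "k \<noteq> 0" "q \<noteq> 1" and uin: "continuous_on UNIV uin"
    and L: "bounded_linear L" "(\<Sum>i\<in>Basis. (L i)\<^sup>2) = - complex_of_real (k\<^sup>2 * q)"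
  shows "(LINT x:D|lebesgue. uin x * exp (L x)) = 0"
proof -
  obtain u w where u: "AE x in lebesgue. x \<notin> D \<longrightarrow> u x = 0" and w: "has_weak_laplacian u w"
    and eq: "AE x in lebesgue. w x + complex_of_real (k\<^sup>2 * q) * u x =
                complex_of_real (k\<^sup>2 * (1 - q)) * uin x * indicator D x"
    using ns unfolding nonscattering_def by blast
  obtain R where R: "D \<subseteq> ball 0 R"
    using D bounded_subset_ballD by blast
  obtain \<eta> :: "real \<times> real \<Rightarrow> complex" where \<eta>: "test_function \<eta>" "\<And>x. x \<in> ball 0 R \<Longrightarrow> \<eta> x = 1"
    using ex_test_function_eq_1_on_ball by blast
  define \<phi> where "\<phi> = (\<lambda>x. \<eta> x * exp (L x))"
  have "{x. \<phi> x \<noteq> 0} = {x. \<eta> x \<noteq> 0}" by (simp add: \<phi>_def)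
  moreover have "C_class n \<phi>" for n
    unfolding \<phi>_def using \<eta>(1) L(1) by (auto simp: test_function_def intro: C_class_mult C_class_exp_linear)
  ultimately have \<phi>: "test_function \<phi>"
    using \<eta>(1) unfolding test_function_def by simp
  have ball: "\<phi> x = 1 * exp (L x)" if "x \<in> ball 0 R" for x
    using \<eta>(2)[OF that] by (simp add: \<phi>_def)
  have pd: "partial_deriv i \<phi> x = L i * exp (L x)" if "x \<in> ball 0 R" for i x
    using partial_deriv_cong_open[OF open_ball that ball]
      partial_deriv_eqI[OF has_derivative_exp_linear[OF L(1), where c = 1]] by simp
  have pd2: "partial_deriv i (partial_deriv i \<phi>) x = (L i)\<^sup>2 * exp (L x)" if "x \<in> ball 0 R" for i x
    using partial_deriv_cong_open[OF open_ball that pd]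
      partial_deriv_eqI[OF has_derivative_exp_linear[OF L(1), where c = "L i"]]
    by (simp add: power2_eq_square)
  have lap: "laplacian \<phi> x = - complex_of_real (k\<^sup>2 * q) * \<phi> x" if "x \<in> D" for x
  proof -
    have x: "x \<in> ball 0 R" using that R by blast
    show ?thesis
      unfolding laplacian_def pd2[OF x] sum_distrib_right[symmetric] L(2) ball[OF x] by simp
  qed
  have L1: "L1_loc u" using w by (rule has_weak_laplacian_L1_loc)
  note int_u = integrable_L1_loc_test_function[OF L1 \<phi>]
  note int_w = has_weak_laplacian_integrable[OF w \<phi>]
  have "continuous_on UNIV (laplacian \<phi>)"
    unfolding laplacian_def
    by (intro continuous_on_sum test_function_continuous test_function_partial_deriv \<phi>)
  then have meas: "(\<lambda>x. u x * laplacian \<phi> x) \<in> borel_measurable lebesgue"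
    using L1 borel_measurable_lebesgue_continuous unfolding L1_loc_def
    by (intro borel_measurable_times) auto
  have "(LINT x|lebesgue. w x * \<phi> x) = (LINT x|lebesgue. u x * laplacian \<phi> x)"
    by (rule has_weak_laplacian_integral[OF w \<phi>])
  also have "\<dots> = (LINT x|lebesgue. - complex_of_real (k\<^sup>2 * q) * (u x * \<phi> x))"
  proof (rule integral_cong_AE[OF meas])
    show "AE x in lebesgue. u x * laplacian \<phi> x = - complex_of_real (k\<^sup>2 * q) * (u x * \<phi> x)"
      using u
    proof (rule AE_mp, intro AE_I2 impI)
      fix x assume "x \<notin> D \<longrightarrow> u x = 0"
      then show "u x * laplacian \<phi> x = - complex_of_real (k\<^sup>2 * q) * (u x * \<phi> x)"
        using lap[of x] by (cases "x \<in> D") auto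
    qed
  qed (use int_u in \<open>auto intro!: borel_measurable_times\<close>)
  also have "\<dots> = - complex_of_real (k\<^sup>2 * q) * (LINT x|lebesgue. u x * \<phi> x)"
    by (rule integral_mult_right_zero)
  finally have "0 = (LINT x|lebesgue. w x * \<phi> x) + complex_of_real (k\<^sup>2 * q) * (LINT x|lebesgue. u x * \<phi> x)"
    by simp
  also have "\<dots> = (LINT x|lebesgue. w x * \<phi> x + complex_of_real (k\<^sup>2 * q) * (u x * \<phi> x))"
    unfolding integral_mult_right_zero[symmetric]
    using int_w int_u by (intro Bochner_Integration.integral_add[symmetric]) auto
  also have "\<dots> = (LINT x|lebesgue. complex_of_real (k\<^sup>2 * (1 - q)) * (indicator D x *\<^sub>R (uin x * exp (L x))))"
  proof (rule integral_cong_AE)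
    show "AE x in lebesgue. w x * \<phi> x + complex_of_real (k\<^sup>2 * q) * (u x * \<phi> x) =
        complex_of_real (k\<^sup>2 * (1 - q)) * (indicator D x *\<^sub>R (uin x * exp (L x)))"
      using eq
    proof (rule AE_mp, intro AE_I2 impI)
      fix x assume e: "w x + complex_of_real (k\<^sup>2 * q) * u x =
                complex_of_real (k\<^sup>2 * (1 - q)) * uin x * indicator D x"
      have "w x * \<phi> x + complex_of_real (k\<^sup>2 * q) * (u x * \<phi> x)
          = (w x + complex_of_real (k\<^sup>2 * q) * u x) * \<phi> x" by (simp add: algebra_simps)
      also have "\<dots> = complex_of_real (k\<^sup>2 * (1 - q)) * (indicator D x *\<^sub>R (uin x * exp (L x)))"
        unfolding e using ball[of x] R by (cases "x \<in> D") auto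
      finally show "w x * \<phi> x + complex_of_real (k\<^sup>2 * q) * (u x * \<phi> x) =
        complex_of_real (k\<^sup>2 * (1 - q)) * (indicator D x *\<^sub>R (uin x * exp (L x)))" .
    qed
    have "continuous_on UNIV (\<lambda>x. uin x * exp (L x))"
      using uin linear_continuous_on[OF L(1)] by (intro continuous_intros)
    then show "(\<lambda>x. complex_of_real (k\<^sup>2 * (1 - q)) * (indicator D x *\<^sub>R (uin x * exp (L x))))
        \<in> borel_measurable lebesgue"
      using D(2) by (intro borel_measurable_times borel_measurable_scaleR
          borel_measurable_lebesgue_continuous borel_measurable_indicator) auto
  qed (use int_w int_u in \<open>auto intro!: borel_measurable_times borel_measurable_add\<close>)
  also have "\<dots> = complex_of_real (k\<^sup>2 * (1 - q)) * (LINT x:D|lebesgue. uin x * exp (L x))"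
    unfolding set_lebesgue_integral_def by (rule integral_mult_right_zero)
  \<comment> \<open>The contrast factor k^2 (1 - q) is nonzero and cancels.\<close>
  finally show ?thesis using k by simp
qed

subsection \<open>The region enclosed by the deltoid\<close>

text \<open>The Cartesian equation of the deltoid. The cubic term is Re (x + iy)^3, which reflects
  the threefold symmetry. The value at the origin is -27, so negative values are to mark the
  inside.\<close>

definition deltoid_poly :: "real \<times> real \<Rightarrow> real" where
  "deltoid_poly = (\<lambda>(x, y). (x\<^sup>2 + y\<^sup>2)\<^sup>2 - 8 * (x ^ 3 - 3 * x * y\<^sup>2) + 18 * (x\<^sup>2 + y\<^sup>2) - 27)"

lemma deltoid_poly_deltoid: "deltoid_poly (deltoid t) = 0"
proof -
  define c s where "c = cos t" and "s = sin t"
  have s2: "s\<^sup>2 = 1 - c\<^sup>2" by (simp add: c_def s_def sin_squared_eq)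
  have d: "deltoid t = (2 * c + 2 * c\<^sup>2 - 1, 2 * s * (1 - c))"
    unfolding deltoid_def c_def s_def cos_double_cos sin_double by (simp add: algebra_simps)
  have y2: "(2 * s * (1 - c))\<^sup>2 = 4 * (1 - c\<^sup>2) * (1 - c)\<^sup>2"
    by (simp add: power_mult_distrib s2)
  show ?thesis
    unfolding d deltoid_poly_def prod.case y2 by algebra
qed

text \<open>In terms of \<open>w = sqrt (2x + 3)\<close> the polynomial, which is quadratic in \<open>y\<^sup>2\<close>, splits.\<close>

lemma deltoid_poly_factor:
  assumes "w\<^sup>2 = 2 * x + 3"
  shows "deltoid_poly (x, y) =
    (y\<^sup>2 - (3 - w) ^ 3 * (1 + w) / 4) * (y\<^sup>2 - (3 + w) ^ 3 * (1 - w) / 4)"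
proof -
  have x: "x = (w\<^sup>2 - 3) / 2" using assms by simp
  show ?thesis unfolding deltoid_poly_def x prod.case by (simp add: field_simps) algebra
qed

text \<open>Here \<open>c\<close> stands for cos t. The second equation forces |c| \<le> 1, since 4
  (1 - c)^2 (1 - c^2) must be a square; then t = arccos c, and the sign of \<open>y\<close> decides
  between t and -t.\<close>

lemma in_deltoid_image:
  assumes "x = 2 * c\<^sup>2 + 2 * c - 1" and y: "y\<^sup>2 = 4 * (1 - c) ^ 3 * (1 + c)"
  shows "(x, y) \<in> deltoid ` {-pi..pi}"
proof -
  have "-1 \<le> c \<and> c \<le> 1"
  proof (rule ccontr)
    assume "\<not> (-1 \<le> c \<and> c \<le> 1)"
    then have "(1 - c) * (1 + c) < 0" by (auto simp: mult_less_0_iff)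
    moreover have "(1 - c)\<^sup>2 > 0" using \<open>\<not> (-1 \<le> c \<and> c \<le> 1)\<close> by auto
    ultimately have "((1 - c) * (1 + c)) * (1 - c)\<^sup>2 < 0" by (rule mult_neg_pos)
    moreover have "y\<^sup>2 = 4 * (((1 - c) * (1 + c)) * (1 - c)\<^sup>2)" unfolding y by algebra
    ultimately show False using zero_le_power2[of y] by linarith
  qed
  then obtain t where t: "0 \<le> t" "t \<le> pi" "cos t = c"
    using arccos_lbound arccos_ubound cos_arccos by blast
  have fst: "fst (deltoid t) = x" "fst (deltoid (- t)) = x"
    using t by (auto simp: deltoid_def cos_double_cos assms)
  have "(sin t)\<^sup>2 = (1 - c) * (1 + c)"
    using t(3) unfolding sin_squared_eq by (simp add: algebra_simps power2_eq_square)
  moreover have snd: "snd (deltoid t) = 2 * sin t * (1 - c)" "snd (deltoid (- t)) = - (2 * sin t * (1 - c))"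
    using t(3) unfolding deltoid_def sin_double by (auto simp: algebra_simps sin_double)
  moreover have "(2 * sin t * (1 - c))\<^sup>2 = 4 * (sin t)\<^sup>2 * (1 - c)\<^sup>2" by (simp add: power_mult_distrib)
  ultimately have "y\<^sup>2 = (snd (deltoid t))\<^sup>2"
    unfolding y by (simp add: power2_eq_square power3_eq_cube)
  then have "y = snd (deltoid t) \<or> y = snd (deltoid (- t))"
    unfolding power2_eq_iff using snd by auto
  then have "(x, y) = deltoid t \<or> (x, y) = deltoid (- t)"
    using fst by (metis prod.collapse)
  moreover have "t \<in> {-pi..pi}" "- t \<in> {-pi..pi}" using t pi_gt_zero by auto
  ultimately show ?thesis by blast
qed

lemma deltoid_poly_eq_0_iff: "deltoid_poly p = 0 \<longleftrightarrow> p \<in> deltoid ` {-pi..pi}"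
proof
  assume F: "deltoid_poly p = 0"
  obtain x y where p: "p = (x, y)" by (cases p)
  show "p \<in> deltoid ` {-pi..pi}"
  proof (cases "2 * x + 3 \<ge> 0")
    case True
    define w where "w = sqrt (2 * x + 3)"
    have w: "w\<^sup>2 = 2 * x + 3" using True by (simp add: w_def)
    \<comment> \<open>On the curve 2x + 3 = (2 cos t + 1)^2, so the cosine is (w - 1)/2 or (-w -
      1)/2; the two factors correspond to these two choices.\<close>
    have "\<exists>c. c\<^sup>2 + c = (w\<^sup>2 - 1) / 4 \<and> y\<^sup>2 = 4 * (1 - c) ^ 3 * (1 + c)"
      using F unfolding p deltoid_poly_factor[OF w] mult_eq_0_iff
    proof (elim disjE)
      assume "y\<^sup>2 - (3 - w) ^ 3 * (1 + w) / 4 = 0"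
      then have "y\<^sup>2 = 4 * (1 - (w - 1) / 2) ^ 3 * (1 + (w - 1) / 2)"
        by (simp add: field_simps power_numeral_reduce)
      moreover have "((w - 1) / 2)\<^sup>2 + (w - 1) / 2 = (w\<^sup>2 - 1) / 4"
        by (simp add: field_simps power2_eq_square)
      ultimately show ?thesis by blast
    next
      assume "y\<^sup>2 - (3 + w) ^ 3 * (1 - w) / 4 = 0"
      then have "y\<^sup>2 = 4 * (1 - (- w - 1) / 2) ^ 3 * (1 + (- w - 1) / 2)"
        by (simp add: field_simps power_numeral_reduce)
      moreover have "((- w - 1) / 2)\<^sup>2 + (- w - 1) / 2 = (w\<^sup>2 - 1) / 4"
        by (simp add: field_simps power2_eq_square)
      ultimately show ?thesis by blast
    qed
    then obtain c where "c\<^sup>2 + c = (w\<^sup>2 - 1) / 4" "y\<^sup>2 = 4 * (1 - c) ^ 3 * (1 + c)" by blast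
    then show ?thesis unfolding p by (intro in_deltoid_image[of _ c]) (use w in auto)
  next
    case False
    \<comment> \<open>Completing the square in y^2; the discriminant is a cube, negative in this
      case, so the polynomial has no zero here.\<close>
    have "4 * deltoid_poly (x, y) = (2 * y\<^sup>2 + 2 * x\<^sup>2 + 24 * x + 18)\<^sup>2 - 16 * (2 * x + 3) ^ 3"
      unfolding deltoid_poly_def by (simp add: field_simps) algebra
    moreover have "(2 * x + 3) ^ 3 < 0" using False by (simp add: power_less_zero_eq)
    moreover have "(2 * y\<^sup>2 + 2 * x\<^sup>2 + 24 * x + 18)\<^sup>2 \<ge> 0" by simp
    ultimately have False using F unfolding p by linarith
    then show ?thesis ..
  qed
qed (auto simp: deltoid_poly_deltoid)

section \<open>The enclosed region as the set where the polynomial is negative\<close>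

lemma deltoid_poly_pos_ray:
  assumes "deltoid_poly p \<ge> 0" "s > 1"
  shows "deltoid_poly (s *\<^sub>R p) > 0"
proof -
  obtain x y where p: "p = (x, y)" by (cases p)
  define R where "R = x\<^sup>2 + y\<^sup>2"
  \<comment> \<open>The cubic terms of F(sp) and s^3 F(p) agree, so their difference involves
    \<open>p\<close> only through \<open>R\<close>. It is divisible by s - 1, and after
    multiplication by s^3 the square in \<open>R\<close> can be completed.\<close>
  have "s ^ 3 * deltoid_poly (s *\<^sub>R p) = s ^ 3 * (s ^ 3 * deltoid_poly p)
      + (s - 1) * ((s ^ 3 * R - 9 * s\<^sup>2)\<^sup>2 + 27 * s ^ 3 * (s - 1)\<^sup>2)"
    unfolding p deltoid_poly_def R_def by simp algebra
  moreover have "(s - 1) * ((s ^ 3 * R - 9 * s\<^sup>2)\<^sup>2 + 27 * s ^ 3 * (s - 1)\<^sup>2) > 0"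
    using assms by (intro mult_pos_pos add_nonneg_pos) auto
  moreover have "s ^ 3 * (s ^ 3 * deltoid_poly p) \<ge> 0" using assms by auto
  ultimately have "s ^ 3 * deltoid_poly (s *\<^sub>R p) > 0" by linarith
  then show ?thesis using assms by (simp add: zero_less_mult_iff)
qed

lemma deltoid_poly_pos_far:
  assumes "norm p > 9"
  shows "deltoid_poly p > 0"
proof -
  obtain x y where p: "p = (x, y)" by (cases p)
  define r where "r = norm p"
  have r: "x\<^sup>2 + y\<^sup>2 = r\<^sup>2" by (simp add: r_def p norm_Pair)
  have "x \<le> r" using r_def p norm_fst_le[of x y] by simp
  have "x ^ 3 - 3 * x * y\<^sup>2 = x * (4 * x\<^sup>2 - 3 * r\<^sup>2)" unfolding r[symmetric] by algebra
  also have "\<dots> \<le> r ^ 3"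
  proof -
    \<comment> \<open>In polar coordinates the subtracted term is r^3 cos(3 \<theta>), by the triple
      angle formula; the factorisation bounds it by r^3 without angles.\<close>
    have "r ^ 3 - x * (4 * x\<^sup>2 - 3 * r\<^sup>2) = (r - x) * (r + 2 * x)\<^sup>2" by algebra
    moreover have "\<dots> \<ge> 0" using \<open>x \<le> r\<close> by simp
    ultimately show ?thesis by linarith
  qed
  finally have "deltoid_poly p \<ge> r ^ 3 * (r - 8) + (18 * r\<^sup>2 - 27)"
    unfolding p deltoid_poly_def prod.case r by (simp add: algebra_simps power_numeral_reduce)
  moreover have "r ^ 3 * (r - 8) > 0" using assms unfolding r_def by (intro mult_pos_pos) auto
  moreover have "r\<^sup>2 \<ge> 9\<^sup>2" using assms unfolding r_def by (intro power_mono) auto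
  ultimately show ?thesis by simp
qed

lemma continuous_deltoid_poly: "continuous_on A deltoid_poly"
  unfolding deltoid_poly_def case_prod_beta by (intro continuous_intros)

lemma compact_deltoid: "compact (deltoid ` {-pi..pi})"
  unfolding deltoid_def by (intro compact_continuous_image continuous_intros) auto

lemma open_deltoid_region: "open deltoid_region"
  unfolding deltoid_region_def by (intro open_inside compact_imp_closed compact_deltoid)

text \<open>If F(p) \<ge> 0, the ray from \<open>p\<close> away from the origin avoids the curve and
  is unbounded, so \<open>p\<close> is not enclosed. If F(p) < 0, the intermediate value theorem
  keeps F negative on the whole component of \<open>p\<close>, and F is positive far away, so that
  component is bounded.\<close>

lemma deltoid_region_eq: "deltoid_region = {p. deltoid_poly p < 0}"
proof (intro subset_antisym subsetI CollectI)
  fix p assume p: "p \<in> deltoid_region"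
  have False if "deltoid_poly p \<ge> 0"
  proof -
    \<comment> \<open>Positivity along the ray is known only for s > 1. Openness provides a starting
      point \<open>a *\<^sub>R p\<close> with a > 1 still in the region.\<close>
    have "((\<lambda>s::real. s *\<^sub>R p) \<longlongrightarrow> 1 *\<^sub>R p) (at_right 1)"
      by (intro tendsto_intros)
    then have "eventually (\<lambda>s::real. s *\<^sub>R p \<in> deltoid_region) (at_right 1)"
      using open_deltoid_region p by (simp add: topological_tendstoD)
    then obtain b :: real where b: "b > 1" "\<And>s. 1 < s \<Longrightarrow> s < b \<Longrightarrow> s *\<^sub>R p \<in> deltoid_region"
      unfolding eventually_at_right_field by blast
    define a where "a = (1 + b) / 2"
    define L where "L = (\<lambda>s. s *\<^sub>R p) ` {a..}"
    have a: "1 < a" "a < b" using b by (auto simp: a_def)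
    have "deltoid_poly 0 < 0" by (simp add: deltoid_poly_def zero_prod_def)
    then have "p \<noteq> 0" using that by auto
    have "connected L" unfolding L_def by (intro connected_continuous_image continuous_intros) auto
    moreover have "L \<subseteq> - (deltoid ` {-pi..pi})"
    proof -
      have "deltoid_poly (s *\<^sub>R p) > 0" if "s \<ge> a" for s
        using deltoid_poly_pos_ray[OF \<open>deltoid_poly p \<ge> 0\<close>] that a by auto
      then have "deltoid_poly z \<noteq> 0" if "z \<in> L" for z using that by (force simp: L_def)
      then show ?thesis unfolding deltoid_poly_eq_0_iff by blast
    qed
    moreover have "a *\<^sub>R p \<in> L" by (auto simp: L_def)
    ultimately have "L \<subseteq> connected_component_set (- (deltoid ` {-pi..pi})) (a *\<^sub>R p)"
      by (rule connected_component_maximal[rotated])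
    moreover have "a *\<^sub>R p \<in> deltoid_region" using b a by auto
    ultimately have "bounded L"
      unfolding deltoid_region_def inside_def using bounded_subset by blast
    then obtain B where B: "\<And>x. x \<in> L \<Longrightarrow> norm x \<le> B" unfolding bounded_iff by blast
    define s where "s = max a (B / norm p + 1)"
    have "norm (s *\<^sub>R p) \<le> B" by (rule B) (auto simp: L_def s_def)
    moreover have "norm (s *\<^sub>R p) \<ge> (B / norm p + 1) * norm p"
      using a unfolding norm_scaleR by (intro mult_right_mono) (auto simp: s_def)
    moreover have "(B / norm p + 1) * norm p > B" using \<open>p \<noteq> 0\<close> by (simp add: distrib_right)
    ultimately show False by linarith
  qed
  then show "deltoid_poly p < 0" by force
next
  fix p assume "p \<in> {p. deltoid_poly p < 0}"
  then have p: "deltoid_poly p < 0" by simp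
  let ?C = "connected_component_set (- (deltoid ` {-pi..pi})) p"
  have "?C \<subseteq> - (deltoid ` {-pi..pi})" by (rule connected_component_subset)
  then have nz: "deltoid_poly z \<noteq> 0" if "z \<in> ?C" for z
    using that unfolding deltoid_poly_eq_0_iff by blast
  have "deltoid_poly z < 0" if z: "z \<in> ?C" for z
  proof (rule ccontr)
    assume "\<not> deltoid_poly z < 0"
    have "p \<notin> deltoid ` {-pi..pi}" using p deltoid_poly_eq_0_iff[of p] by linarith
    then have "p \<in> ?C" by simp
    have "connected (deltoid_poly ` ?C)"
      by (intro connected_continuous_image continuous_deltoid_poly connected_connected_component)
    then have "0 \<in> deltoid_poly ` ?C"
      using connectedD_interval[of "deltoid_poly ` ?C" "deltoid_poly p" "deltoid_poly z" 0]
        \<open>p \<in> ?C\<close> z p \<open>\<not> deltoid_poly z < 0\<close> by auto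
    then show False using nz by auto
  qed
  then have "?C \<subseteq> cball 0 9"
    using deltoid_poly_pos_far by (force simp: not_le[symmetric])
  then have "bounded ?C" using bounded_subset bounded_cball by blast
  moreover have "p \<notin> deltoid ` {-pi..pi}" using p deltoid_poly_eq_0_iff[of p] by linarith
  ultimately show "p \<in> deltoid_region" by (simp add: deltoid_region_def inside_def)
qed

lemma deltoid_region_subset_ball: "deltoid_region \<subseteq> cball 0 9"
  unfolding deltoid_region_eq using deltoid_poly_pos_far by (force simp: not_le[symmetric])

section \<open>Two-sided bounds for the width at the cusp\<close>

text \<open>For x > -1 we have w > 1, so the second factor of the polynomial is positive and the
  first must be negative. As 3 - x = (3 - w)(3 + w)/2, the cube (3 - w)^3 is comparable to (3 -
  x)^3; ((3 + w)/2)^3 \<ge> 8 leaves room for the constant 1/3.\<close>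

lemma deltoid_region_cusp_upper:
  assumes "(x, y) \<in> deltoid_region" "x > -1"
  shows "x < 3" "y\<^sup>2 \<le> (3 - x) ^ 3 / 3"
proof -
  define w where "w = sqrt (2 * x + 3)"
  have w: "w\<^sup>2 = 2 * x + 3" "w > 1" using assms by (auto simp: w_def)
  have neg: "(3 + w) ^ 3 * (1 - w) / 4 < 0" using w by (simp add: mult_pos_neg)
  have "(y\<^sup>2 - (3 - w) ^ 3 * (1 + w) / 4) * (y\<^sup>2 - (3 + w) ^ 3 * (1 - w) / 4) < 0"
    using assms deltoid_poly_factor[OF w(1)] by (simp add: deltoid_region_eq)
  moreover have "y\<^sup>2 - (3 + w) ^ 3 * (1 - w) / 4 > 0" using neg zero_le_power2[of y] by linarith
  ultimately have y: "y\<^sup>2 < (3 - w) ^ 3 * (1 + w) / 4" by (simp add: mult_less_0_iff)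
  then have "(3 - w) ^ 3 * (1 + w) > 0" using zero_le_power2[of y] by linarith
  then have w3: "w < 3" using w by (simp add: zero_less_mult_iff zero_less_power_eq)
  have eq: "3 - x = (3 - w) * (3 + w) / 2" using w by (simp add: algebra_simps power2_eq_square)
  show "x < 3" using w w3 eq by (smt (verit) divide_pos_pos mult_pos_pos)
  have "(1 + w) / 4 \<le> ((3 + w) / 2) ^ 3 / 3"
  proof -
    have "((3 + w) / 2) ^ 3 \<ge> 2 ^ 3" using w by (intro power_mono) auto
    then show ?thesis using w3 by simp
  qed
  then have "(3 - w) ^ 3 * ((1 + w) / 4) \<le> (3 - w) ^ 3 * (((3 + w) / 2) ^ 3 / 3)"
    using w3 by (intro mult_left_mono) auto
  also have "\<dots> = (3 - x) ^ 3 / 3" unfolding eq by (simp add: power_mult_distrib power_divide)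
  finally show "y\<^sup>2 \<le> (3 - x) ^ 3 / 3" using y by simp
qed

text \<open>The same factorisation read backwards. The constant 54 is 2 * 27: ((3 + w)/2)^3 \<le>
  27, while (1 + w)/4 \<ge> 1/2.\<close>

lemma deltoid_region_cusp_lower:
  assumes "-1 < x" "x < 3" "y\<^sup>2 < (3 - x) ^ 3 / 54"
  shows "(x, y) \<in> deltoid_region"
proof -
  define w where "w = sqrt (2 * x + 3)"
  have w: "w\<^sup>2 = 2 * x + 3" "w > 1" using assms by (auto simp: w_def)
  have w3: "w < 3" unfolding w_def using assms by (intro real_less_lsqrt) auto
  have eq: "3 - x = (3 - w) * (3 + w) / 2" using w by (simp add: algebra_simps power2_eq_square)
  have "((3 + w) / 2) ^ 3 \<le> 3 ^ 3" using w w3 by (intro power_mono) auto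
  then have "((3 + w) / 2) ^ 3 / 54 \<le> (1 + w) / 4" using w by simp
  then have "(3 - w) ^ 3 * (((3 + w) / 2) ^ 3 / 54) \<le> (3 - w) ^ 3 * ((1 + w) / 4)"
    using w3 by (intro mult_left_mono) auto
  moreover have "(3 - w) ^ 3 * (((3 + w) / 2) ^ 3 / 54) = (3 - x) ^ 3 / 54"
    unfolding eq by (simp add: power_mult_distrib power_divide)
  ultimately have "y\<^sup>2 - (3 - w) ^ 3 * (1 + w) / 4 < 0" using assms by simp
  moreover have "(3 + w) ^ 3 * (1 - w) / 4 < 0" using w by (simp add: mult_pos_neg)
  then have "y\<^sup>2 - (3 + w) ^ 3 * (1 - w) / 4 > 0" using zero_le_power2[of y] by linarith
  ultimately have "deltoid_poly (x, y) < 0"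
    unfolding deltoid_poly_factor[OF w(1)] by (rule mult_neg_pos)
  then show ?thesis by (simp add: deltoid_region_eq)
qed

subsection \<open>Asymptotics at the cusp\<close>

text \<open>Both replacing \<open>c\<close> by \<open>z\<close> and rotating by \<theta> cost at
  most a quarter of |c|, the latter because |exp(i \<theta>) - 1| = 2 |sin(\<theta>/2)| \<le>
  |\<theta>|. Half of |c|^2 survives.\<close>

lemma Re_cnj_mult_exp_ge:
  assumes "norm (z - c) \<le> norm c / 4" "\<bar>\<theta>\<bar> \<le> 1 / 4"
  shows "Re (cnj c * z * exp (\<i> * complex_of_real \<theta>)) \<ge> (norm c)\<^sup>2 / 2"
proof -
  let ?e = "exp (\<i> * complex_of_real \<theta>)"
  define d where "d = (z - c) * ?e + c * (?e - 1)"
  have "norm (?e - 1) \<le> \<bar>\<theta>\<bar>"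
    using abs_sin_x_le_abs_x[of "\<theta> / 2"] by (simp add: dist_exp_i_1)
  then have "norm c * norm (?e - 1) \<le> norm c * (1 / 4)"
    using assms(2) by (intro mult_left_mono) auto
  moreover have "norm d \<le> norm ((z - c) * ?e) + norm (c * (?e - 1))"
    unfolding d_def by (rule norm_triangle_ineq)
  ultimately have "norm d \<le> norm c / 2" using assms(1) by (simp add: norm_mult)
  then have "norm c * norm d \<le> norm c * (norm c / 2)" by (intro mult_left_mono) auto
  then have "norm (cnj c * d) \<le> (norm c)\<^sup>2 / 2" by (simp add: norm_mult power2_eq_square)
  then have "Re (cnj c * d) \<ge> - ((norm c)\<^sup>2 / 2)"
    using abs_Re_le_cmod[of "cnj c * d"] by linarith
  moreover have "cnj c * z * ?e = cnj c * c + cnj c * d" by (simp add: d_def algebra_simps)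
  moreover have "Re (cnj c * c) = (norm c)\<^sup>2"
    by (metis Re_complex_of_real complex_norm_square mult.commute)
  ultimately show ?thesis by simp
qed

lemma deltoid_region_near_cusp:
  assumes "(x, y) \<in> deltoid_region" "m \<ge> 1" "3 - 1 / (4 * m\<^sup>2) < x"
    and b: "b\<^sup>2 \<le> 4 * (m ^ 3)\<^sup>2"
  shows "x < 3" "\<bar>b * y\<bar> \<le> 1 / 4" "dist (x, y) (3, 0) \<le> 1 / m"
proof -
  define s where "s = 3 - x"
  have m2: "m\<^sup>2 \<ge> m" using assms(2) by (simp add: power2_eq_square)
  then have "1 / (4 * m\<^sup>2) \<le> 1 / (4 * m)" using assms(2) by (intro divide_left_mono) auto
  moreover have "1 / (4 * m) \<le> 1 / 4" using assms(2) by simp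
  ultimately have s: "s < 1 / (4 * m\<^sup>2)" "s \<le> 1 / (4 * m)" "s \<le> 1 / 4"
    using assms(3) unfolding s_def by linarith+
  then have "x > -1" by (simp add: s_def)
  note up = deltoid_region_cusp_upper[OF assms(1) this, folded s_def]
  show "x < 3" by (rule up(1))
  then have s0: "s > 0" by (simp add: s_def)
  \<comment> \<open>The phase is controlled by m^2 s alone, because b^2 is of order m^6 and y^2 of
    order s^3. This is why the cutoff for s = 3 - x is of order 1/m^2, much wider than the scale
    1/m^3 of the exponential.\<close>
  have "b\<^sup>2 * y\<^sup>2 \<le> (4 * (m ^ 3)\<^sup>2) * (s ^ 3 / 3)" using b up(2) by (intro mult_mono) auto
  also have "\<dots> = 4 / 3 * (m\<^sup>2 * s) ^ 3" by (simp add: power_mult_distrib flip: power_mult)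
  also have "\<dots> \<le> 4 / 3 * (1 / 4) ^ 3"
    using s s0 assms(2) by (intro mult_left_mono power_mono) (auto simp: field_simps)
  also have "\<dots> \<le> (1 / 4)\<^sup>2" by (simp add: power_numeral_reduce)
  finally have "(b * y)\<^sup>2 \<le> (1 / 4)\<^sup>2" by (simp add: power_mult_distrib)
  then show "\<bar>b * y\<bar> \<le> 1 / 4" using abs_le_square_iff[of "b * y" "1 / 4"] by simp
  have "s ^ 3 / 3 \<le> s\<^sup>2" using s s0 by (simp add: power2_eq_square power3_eq_cube)
  then have "\<bar>y\<bar> \<le> s" using up(2) s0 abs_le_square_iff[of y s] by simp
  have "dist (x, y) (3, 0) \<le> dist x 3 + dist y 0"
    unfolding dist_Pair_Pair by (rule sqrt_sum_squares_le_sum) auto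
  also have "\<dots> \<le> 2 * s" using \<open>\<bar>y\<bar> \<le> s\<close> s0 by (simp add: dist_real_def s_def)
  also have "\<dots> \<le> 2 * (1 / (4 * m))" using s by simp
  also have "\<dots> \<le> 1 / m" using assms(2) by (simp add: field_simps)
  finally show "dist (x, y) (3, 0) \<le> 1 / m" .
qed

text \<open>At distance 1/m^3 from the cusp the region has width of order m^(-9/2). The height of
  order m^(-5) avoids roots and costs only a power of m.\<close>

lemma box_subset_deltoid_region:
  assumes "m \<ge> (1::real)"
  shows "cbox (3 - 2 / m ^ 3, - 1 / (8 * m ^ 5)) (3 - 1 / m ^ 3, 1 / (8 * m ^ 5)) \<subseteq> deltoid_region"
proof (rule subrelI)
  fix x y assume "(x, y) \<in> cbox (3 - 2 / m ^ 3, - 1 / (8 * m ^ 5)) (3 - 1 / m ^ 3, 1 / (8 * m ^ 5))"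
  then have x: "3 - 2 / m ^ 3 \<le> x" "x \<le> 3 - 1 / m ^ 3" and y: "\<bar>y\<bar> \<le> 1 / (8 * m ^ 5)"
    by (auto simp: mem_box Basis_prod_def)
  have m3: "m ^ 3 \<ge> 1" using assms by simp
  have "2 / m ^ 3 \<le> 2" using divide_left_mono[OF m3, of 2] assms by simp
  have "1 / m ^ 3 > 0" using assms by simp
  have "y\<^sup>2 \<le> (1 / (8 * m ^ 5))\<^sup>2" using power_mono[OF y, of 2] by simp
  also have "\<dots> = 1 / (64 * m ^ 10)" by (simp add: power_divide power_mult_distrib flip: power_mult)
  also have "\<dots> < 1 / (54 * m ^ 9)"
  proof (rule divide_strict_left_mono)
    have "m ^ 9 * 1 \<le> m ^ 9 * m" using assms by (intro mult_left_mono) auto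
    moreover have "m ^ 9 * m = m ^ 10" by (simp add: power_numeral_reduce)
    moreover have "m ^ 9 > 0" using assms by simp
    ultimately show "54 * m ^ 9 < 64 * m ^ 10" by linarith
  qed (use assms in auto)
  also have "\<dots> = (1 / m ^ 3) ^ 3 / 54" by (simp add: power_divide flip: power_mult)
  also have "\<dots> \<le> (3 - x) ^ 3 / 54" using x assms by (intro divide_right_mono power_mono) auto
  finally show "(x, y) \<in> deltoid_region"
    using x \<open>2 / m ^ 3 \<le> 2\<close> \<open>1 / m ^ 3 > 0\<close> by (intro deltoid_region_cusp_lower) linarith+
qed

lemma set_integrable_continuous_bounded:
  fixes f :: "'a::euclidean_space \<Rightarrow> 'b::{banach, second_countable_topology}"
  assumes "continuous_on UNIV f" "D \<in> sets lebesgue" "bounded D"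
  shows "set_integrable lebesgue D f"
proof -
  obtain R where "D \<subseteq> cball 0 R"
    using bounded_subset_ballD[OF assms(3), of 0] ball_subset_cball by (meson subset_trans)
  moreover have "set_integrable lebesgue (cball 0 R) f"
  proof -
    have "integrable lborel (\<lambda>x. indicator (cball 0 R) x *\<^sub>R f x)"
      using assms(1) by (intro borel_integrable_compact) (auto intro: continuous_on_subset)
    then show ?thesis
      unfolding set_integrable_def using borel_measurable_integrable
      by (subst integrable_completion) auto
  qed
  ultimately show ?thesis using assms(2) set_integrable_subset by blast
qed

text \<open>With \<open>a = m\<^sup>3\<close> as exponent the integrand has nonnegative real part, after normalisation, for
  \<open>3 - x < 1 / (4m\<^sup>2)\<close>; elsewhere the exponential is at most \<open>exp (- m / 4)\<close>. The left-hand side is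
  the contribution of a box next to the cusp, on which \<open>3 - x\<close> is of order \<open>1/a\<close>.\<close>

lemma cusp_integral_lower_bound:
  fixes f :: "real \<times> real \<Rightarrow> complex" and m b M :: real
  assumes f: "continuous_on UNIV f" and M: "\<And>p. p \<in> cball 0 9 \<Longrightarrow> norm (f p) \<le> M"
    and near: "\<And>p. dist p (3, 0) \<le> 1 / m \<Longrightarrow> norm (f p - f (3, 0)) \<le> norm (f (3, 0)) / 4"
    and m: "m > 8" and b: "b\<^sup>2 \<le> 4 * (m ^ 3)\<^sup>2"
    and zero: "(LINT p:deltoid_region|lebesgue.
       f p * exp (complex_of_real (m ^ 3 * fst p) + \<i> * complex_of_real (b * snd p))) = 0"
  shows "(norm (f (3, 0)))\<^sup>2 / 2 * exp (- 2) * (1 / (4 * m ^ 8))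
    \<le> norm (f (3, 0)) * M * exp (- m / 4) * measure lebesgue deltoid_region"
proof -
  let ?D = deltoid_region and ?c = "f (3, 0)"
  define a where "a = m ^ 3"
  define E where "E p = exp (complex_of_real (a * fst p) + \<i> * complex_of_real (b * snd p))" for p :: "real \<times> real"
  \<comment> \<open>Normalisation: the conjugate makes the value at the cusp the real number |c|^2,
    and exp(-3a) centres the exponential at x = 3.\<close>
  define K where "K = cnj ?c * complex_of_real (exp (- (3 * a)))"
  define F where "F p = K * (f p * E p)" for p
  define B where "B = cbox (3 - 2 / m ^ 3, - 1 / (8 * m ^ 5)) (3 - 1 / m ^ 3, 1 / (8 * m ^ 5))"
  define c1 where "c1 = (norm ?c)\<^sup>2 / 2 * exp (- 2)"
  define c2 where "c2 = norm ?c * M * exp (- m / 4)"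
  have D: "?D \<in> sets lebesgue" "bounded ?D"
    using open_deltoid_region bounded_subset[OF bounded_cball deltoid_region_subset_ball] by auto
  have Dfin: "emeasure lebesgue ?D < \<infinity>" using D bounded_set_imp_lmeasurable unfolding fmeasurable_def by blast
  have BD: "B \<subseteq> ?D" unfolding B_def using m by (intro box_subset_deltoid_region) simp
  have contF: "continuous_on UNIV F"
    unfolding F_def E_def by (intro continuous_intros f)
  have intF: "integrable lebesgue (\<lambda>p. indicator ?D p *\<^sub>R F p)"
    using set_integrable_continuous_bounded[OF contF D] unfolding set_integrable_def .
  have "(LINT p|lebesgue. indicator ?D p *\<^sub>R F p) = K * (LINT p:?D|lebesgue. f p * E p)"
    unfolding F_def set_lebesgue_integral_def by (simp flip: integral_mult_right_zero)
  then have zero': "(LINT p|lebesgue. indicator ?D p *\<^sub>R F p) = 0"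
    using zero by (simp add: E_def a_def)
  have F: "F (x, y) = complex_of_real (exp (a * (x - 3))) * (cnj ?c * f (x, y) * exp (\<i> * complex_of_real (b * y)))" for x y
  proof -
    have "exp (a * (x - 3)) = exp (- (3 * a)) * exp (a * x)"
      by (simp add: algebra_simps flip: exp_add)
    then show ?thesis by (simp add: F_def K_def E_def exp_add exp_of_real flip: of_real_mult)
  qed
  \<comment> \<open>Equivalent to m > 8 for positive m; it places the box inside the zone without
    oscillation.\<close>
  have far: "2 / m ^ 3 < 1 / (4 * m\<^sup>2)" using m by (simp add: field_simps power2_eq_square power3_eq_cube)
  \<comment> \<open>A minorant of the real part: near the cusp it is nonnegative, and at least
    \<open>c1\<close> on the box; elsewhere it is at least \<open>- c2\<close>. Integrating gives
    the claim.\<close>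
  have ptw: "c1 * indicator B p - c2 * indicator ?D p \<le> Re (indicator ?D p *\<^sub>R F p)" for p
  proof -
    obtain x y where p: "p = (x, y)" by (cases p)
    have M0: "M \<ge> 0" using M[of 0] by (auto intro: order_trans[OF norm_ge_zero])
    have c2: "c2 \<ge> 0" using M0 by (simp add: c2_def)
    show ?thesis
    proof (cases "p \<in> ?D")
      case False
      then show ?thesis using BD by (auto simp: indicator_def)
    next
      case pD: True
      show ?thesis
      proof (cases "3 - 1 / (4 * m\<^sup>2) < x")
        case True
        note near_cusp = deltoid_region_near_cusp[OF pD[unfolded p] _ True b]
        have "Re (cnj ?c * f (x, y) * exp (\<i> * complex_of_real (b * y))) \<ge> (norm ?c)\<^sup>2 / 2"
          using m near_cusp by (intro Re_cnj_mult_exp_ge near) auto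
        then have ReF: "exp (a * (x - 3)) * ((norm ?c)\<^sup>2 / 2) \<le> Re (F p)"
          unfolding p F scaleR_conv_of_real[symmetric] by (simp add: mult_left_mono)
        moreover have "c1 * indicator B p \<le> exp (a * (x - 3)) * ((norm ?c)\<^sup>2 / 2)"
        proof (cases "p \<in> B")
          case True
          then have "3 - 2 / m ^ 3 \<le> x" by (auto simp: B_def p mem_box Basis_prod_def)
          then have "m ^ 3 * (x - 3) \<ge> - 2" using m by (simp add: field_simps)
          then have "exp (- 2) \<le> exp (a * (x - 3))" by (simp add: a_def)
          then have "exp (- 2) * ((norm ?c)\<^sup>2 / 2) \<le> exp (a * (x - 3)) * ((norm ?c)\<^sup>2 / 2)"
            by (intro mult_right_mono) auto
          with True show ?thesis by (simp add: c1_def mult.commute)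
        qed auto
        ultimately show ?thesis using pD c2 by simp
      next
        case False
        have "p \<notin> B" using False far by (auto simp: B_def p mem_box Basis_prod_def)
        have "a * (x - 3) \<le> a * (- (1 / (4 * m\<^sup>2)))"
          using False m unfolding a_def by (intro mult_left_mono) auto
        also have "\<dots> = - m / 4" using m by (simp add: a_def power2_eq_square power3_eq_cube)
        finally have "exp (a * (x - 3)) \<le> exp (- m / 4)" by simp
        moreover have "norm ?c * norm (f p) \<le> norm ?c * M"
          using M[of p] pD deltoid_region_subset_ball by (intro mult_left_mono norm_ge_zero) blast
        ultimately have "exp (a * (x - 3)) * (norm ?c * norm (f p)) \<le> exp (- m / 4) * (norm ?c * M)"
          by (rule mult_mono) auto
        moreover have "norm (F p) = exp (a * (x - 3)) * (norm ?c * norm (f p))"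
          unfolding p F by (simp add: norm_mult)
        ultimately have "norm (F p) \<le> c2" by (simp add: c2_def mult_ac)
        then have "Re (F p) \<ge> - c2" using abs_Re_le_cmod[of "F p"] by linarith
        with pD \<open>p \<notin> B\<close> show ?thesis by simp
      qed
    qed
  qed
  have intB: "integrable lebesgue (\<lambda>p. c1 * indicator B p)"
    using emeasure_lborel_cbox_finite unfolding B_def
    by (intro integrable_mult_right integrable_real_indicator) auto
  have intD: "integrable lebesgue (\<lambda>p. c2 * indicator ?D p)"
    using D(1) Dfin by (intro integrable_mult_right integrable_real_indicator) auto
  have "c1 * measure lebesgue B - c2 * measure lebesgue ?D
      = (LINT p|lebesgue. c1 * indicator B p - c2 * indicator ?D p)"
    using intB intD by simp
  also have "\<dots> \<le> (LINT p|lebesgue. Re (indicator ?D p *\<^sub>R F p))"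
    by (intro integral_mono ptw Bochner_Integration.integrable_diff intB intD integrable_Re intF)
  also have "\<dots> = 0" using zero' integral_Re[OF intF] by simp
  finally have "c1 * measure lebesgue B \<le> c2 * measure lebesgue ?D" by simp
  moreover have "measure lebesgue B = 1 / (4 * m ^ 8)"
  proof -
    have "3 - 2 / m ^ 3 \<le> 3 - 1 / m ^ 3" using m by (simp add: divide_right_mono)
    moreover have "- 1 / (8 * m ^ 5) \<le> 1 / (8 * m ^ 5)" using m by simp
    ultimately have "measure lborel B = (3 - 1 / m ^ 3 - (3 - 2 / m ^ 3)) * (1 / (8 * m ^ 5) - - 1 / (8 * m ^ 5))"
      unfolding B_def by (simp only: content_Pair cbox_interval[where 'a = real] measure_lborel_Icc)
    also have "\<dots> = (1 / m ^ 3) * (1 / (4 * m ^ 5))" by (simp add: diff_divide_distrib[symmetric])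
    also have "\<dots> = 1 / (4 * m ^ 8)" by (simp add: power_add[symmetric])
    finally show ?thesis by (simp add: B_def)
  qed
  ultimately show ?thesis by (simp add: c1_def c2_def)
qed

section \<open>The contradiction as m tends to infinity\<close>

theorem corollary3p11:
  fixes k q :: real and uin :: "real \<times> real \<Rightarrow> complex"
  assumes "k > 0"
    and "0 < q" and "q \<noteq> 1"
    and "incident_wave k uin"
    and "uin (3, 0) \<noteq> 0"
  shows "scattered k q deltoid_region uin"
  unfolding scattered_def
proof
  assume ns: "nonscattering k q deltoid_region uin"
  have cont: "continuous_on UNIV uin"
    using assms(4) C_class_imp_continuous unfolding incident_wave_def by blast
  have D: "deltoid_region \<in> sets lebesgue" "bounded deltoid_region"
    using open_deltoid_region bounded_subset[OF bounded_cball deltoid_region_subset_ball] by auto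
  obtain M where M: "\<And>p. p \<in> cball 0 9 \<Longrightarrow> norm (uin p) \<le> M"
  proof -
    have "compact (uin ` cball 0 9)"
      by (intro compact_continuous_image continuous_on_subset[OF cont]) auto
    then have "bounded (uin ` cball 0 9)" by (rule compact_imp_bounded)
    then obtain M where "\<forall>z\<in>uin ` cball 0 9. norm z \<le> M" unfolding bounded_iff ..
    then show ?thesis by (intro that[of M]) blast
  qed
  have "norm (uin (3, 0)) / 4 > 0" using assms(5) by simp
  then have "\<exists>\<delta>>0. \<forall>p. dist p (3, 0) < \<delta> \<longrightarrow> dist (uin p) (uin (3, 0)) < norm (uin (3, 0)) / 4"
    using cont[unfolded continuous_on_iff, rule_format, of "(3, 0)" "norm (uin (3, 0)) / 4"] by blast
  then obtain \<delta> where \<delta>: "\<delta> > 0"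
    "\<And>p. dist p (3, 0) < \<delta> \<Longrightarrow> norm (uin p - uin (3, 0)) < norm (uin (3, 0)) / 4"
    unfolding dist_norm by blast
  let ?l = "(norm (uin (3, 0)))\<^sup>2 / 2 * exp (- 2) / 4"
  let ?C = "norm (uin (3, 0)) * M * measure lebesgue deltoid_region"
  have "eventually (\<lambda>m::real. ?l \<le> ?C * (m ^ 8 * exp (- m / 4))) at_top"
    \<comment> \<open>The thresholds serve, in turn, the box and cusp estimates, the continuity of
      \<open>uin\<close> at the cusp within distance 1/m, and b^2 \<le> 4 m^6.\<close>
    using eventually_gt_at_top[of 8] eventually_gt_at_top[of "1 / \<delta>"] eventually_gt_at_top[of "k\<^sup>2 * q"]
  proof eventually_elim
    case (elim m)
    \<comment> \<open>Chosen so that a^2 - b^2 = - k^2 q with a = m^3.\<close>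
    define b where "b = sqrt ((m ^ 3)\<^sup>2 + k\<^sup>2 * q)"
    have b2: "b\<^sup>2 = (m ^ 3)\<^sup>2 + k\<^sup>2 * q" using assms by (simp add: b_def)
    have "m ^ 1 \<le> m ^ 6" using elim by (intro power_increasing) auto
    then have b: "b\<^sup>2 \<le> 4 * (m ^ 3)\<^sup>2" using elim unfolding b2 by (simp flip: power_mult)
    let ?L = "\<lambda>p. complex_of_real (m ^ 3 * fst p) + \<i> * complex_of_real (b * snd p)"
    have L: "bounded_linear ?L"
      by (rule bounded_linear_add)
        (rule bounded_linear_compose[OF bounded_linear_of_real]
              bounded_linear_compose[OF bounded_linear_mult_right]
              bounded_linear_compose[OF bounded_linear_compose[OF bounded_linear_mult_right bounded_linear_of_real]]
              bounded_linear_compose[OF bounded_linear_mult_right bounded_linear_fst]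
              bounded_linear_compose[OF bounded_linear_mult_right bounded_linear_snd])+
    have Basis: "(Basis :: (real \<times> real) set) = {(1, 0), (0, 1)}" by (auto simp: Basis_prod_def)
    have "(\<Sum>i\<in>Basis. (?L i)\<^sup>2) = complex_of_real ((m ^ 3)\<^sup>2 - b\<^sup>2)"
      unfolding Basis by (simp add: power_mult_distrib)
    also have "\<dots> = - complex_of_real (k\<^sup>2 * q)" by (simp add: b2)
    finally have sq: "(\<Sum>i\<in>Basis. (?L i)\<^sup>2) = - complex_of_real (k\<^sup>2 * q)" .
    have zero: "(LINT p:deltoid_region|lebesgue. uin p * exp (?L p)) = 0"
      using assms(1,3) by (intro nonscattering_integral_exp_eq_0[OF ns D(2,1) _ _ cont L sq]) simp_all
    have "1 / m < \<delta>" using elim \<delta>(1) by (simp add: field_simps)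
    then have "norm (uin p - uin (3, 0)) \<le> norm (uin (3, 0)) / 4" if "dist p (3, 0) \<le> 1 / m" for p
      using \<delta>(2)[of p] that by linarith
    from cusp_integral_lower_bound[OF cont M this _ b zero] elim
    have "?l * (1 / m ^ 8) \<le> ?C * exp (- m / 4)" by (simp add: mult_ac)
    moreover have "m ^ 8 > 0" using elim by simp
    ultimately have "?l \<le> ?C * exp (- m / 4) * m ^ 8" by (simp add: pos_divide_le_eq)
    then show ?case by (simp only: mult_ac)
  qed
  moreover have "((\<lambda>m::real. ?C * (m ^ 8 * exp (- m / 4))) \<longlongrightarrow> ?C * 0) at_top"
  proof (intro tendsto_mult tendsto_const)
    have "filterlim (\<lambda>m::real. 1 / 4 * m) at_top at_top"
      by (rule filterlim_tendsto_pos_mult_at_top[OF tendsto_const _ filterlim_ident]) simp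
    \<comment> \<open>The standard limit t^8 / exp t at t = m/4; the factor 4^8 restores
      m^8.\<close>
    from tendsto_mult_right_zero[OF filterlim_compose[OF tendsto_power_div_exp_0[of 8] this], of "4 ^ 8"]
    have "((\<lambda>m::real. 4 ^ 8 * ((1 / 4 * m) ^ 8 / exp (1 / 4 * m))) \<longlongrightarrow> 0) at_top" .
    moreover have "4 ^ 8 * ((1 / 4 * m) ^ 8 / exp (1 / 4 * m)) = m ^ 8 * exp (- m / 4)" for m :: real
      using exp_minus_inverse[of "m / 4"] by (simp add: power_divide field_simps)
    ultimately show "((\<lambda>m::real. m ^ 8 * exp (- m / 4)) \<longlongrightarrow> 0) at_top" by (simp only:)
  qed
  ultimately have "?l \<le> ?C * 0"
    by (intro tendsto_lowerbound) auto
  moreover have "?l > 0" using assms(5) by simp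
  ultimately show False by simp
qed

end
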